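(* Let $\alpha'>0$, $\delta c>0$, $r_0>0$ and $\Phi_0\in\mathbb{R}$ be constants, and set $$a=-\frac{5\,\delta c}{216}<0,\qquad k_s^2=-\frac{5a}{\alpha'} .$$ Then the one-parameter family (with parameter $\lambda\in\mathbb{R}$) of metrics and scalar fields in coordinates $(u,v,x,y)$, on the region $uv<r_0^2e^{2a\lambda}$, $$ds^2=-k_s^{-2}\,\frac{du\,dv}{r_0^2e^{2a\lambda}-uv}+dx^2+dy^2,\qquad \Phi=-\frac35\log\left[k_s^2\left(r_0^2e^{2a\lambda}-uv\right)\right]+\Phi_0,$$ satisfies the renormalization group flow equations $$\frac{\partial \tilde g_{\mu\nu}}{\partial\lambda}=-\alpha'\left(\widetilde R_{\mu\nu}+2\widetilde\nabla_\mu\widetilde\nabla_\nu\Phi\right),\qquad \frac{\partial\Phi}{\partial\lambda}=\delta c-\frac32\alpha'\left[4(\tilde\partial\Phi)^2-4\widetilde\Box\Phi-\widetilde R\right].$$ In particular the horizon parameter $r_h(\lambda)=r_0e^{a\lambda}$ tends to $0$ as $\lambda\to\infty$.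
   Context: The $\lambda$-derivatives are taken at fixed coordinates $(u,v,x,y)$. $\tilde g_{\mu\nu}$ is the metric with line element $ds^2$ at the given $\lambda$; $\widetilde R_{\mu\nu}$ and $\widetilde R$ are its Ricci tensor and Ricci scalar (sign convention: round spheres have positive Ricci scalar), $\widetilde\nabla$ its Levi-Civita connection, $\widetilde\Box=\tilde g^{\mu\nu}\widetilde\nabla_\mu\widetilde\nabla_\nu$, and $(\tilde\partial\Phi)^2=\tilde g^{\mu\nu}\partial_\mu\Phi\,\partial_\nu\Phi$. The notation $-F\,du\,dv$ in a line element means $\tilde g_{uv}=\tilde g_{vu}=-F/2$, $\tilde g_{uu}=\tilde g_{vv}=0$. *)

theory Defs
  imports "HOL-Analysis.Analysis"
begin

section \<open>Tensor calculus in a coordinate chart\<close>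

text \<open>
  A tensor field is given by its components, as functions of the coordinate vector
  \<open>p :: real ^ 'n\<close>; \<open>metric\<close> is the type of the matrix of covariant components \<open>g\<^sub>\<mu>\<^sub>\<nu>\<close>.
\<close>

definition pd :: "'n::finite \<Rightarrow> (real ^ 'n \<Rightarrow> real) \<Rightarrow> real ^ 'n \<Rightarrow> real" where
  "pd i f p = deriv (\<lambda>t. f (p + t *\<^sub>R axis i 1)) 0"

text \<open>
  \<open>pd\<close> carries no information where the function is not differentiable, so regularity is recorded
  separately.  The derivatives in \<open>Ck_on\<close> are full (not one-sided) derivatives at the points of
  \<open>S\<close>, so for \<open>k > 0\<close> the predicate is meant for open \<open>S\<close>.
\<close>

primrec Ck_on :: "nat \<Rightarrow> (real ^ 'n::finite) set \<Rightarrow> (real ^ 'n \<Rightarrow> real) \<Rightarrow> bool" where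
  "Ck_on 0 S f \<longleftrightarrow> continuous_on S f"
| "Ck_on (Suc k) S f \<longleftrightarrow> (\<forall>p\<in>S. f differentiable (at p)) \<and> (\<forall>i. Ck_on k S (pd i f))"

definition smooth_on :: "(real ^ 'n::finite) set \<Rightarrow> (real ^ 'n \<Rightarrow> real) \<Rightarrow> bool" where
  "smooth_on S f \<longleftrightarrow> (\<forall>k. Ck_on k S f)"

type_synonym 'n metric = "real ^ 'n \<Rightarrow> real ^ 'n ^ 'n"

definition metric_on :: "(real ^ 'n::finite) set \<Rightarrow> 'n metric \<Rightarrow> bool" where
  "metric_on S g \<longleftrightarrow>
     (\<forall>\<mu> \<nu>. smooth_on S (\<lambda>p. g p $ \<mu> $ \<nu>)) \<and>
     (\<forall>p\<in>S. transpose (g p) = g p \<and> invertible (g p))"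

definition ginv :: "'n::finite metric \<Rightarrow> 'n \<Rightarrow> 'n \<Rightarrow> real ^ 'n \<Rightarrow> real" where
  "ginv g \<mu> \<nu> p = matrix_inv (g p) $ \<mu> $ \<nu>"

text \<open>\<open>christoffel g \<rho> \<mu> \<nu>\<close> is the Christoffel symbol of the Levi-Civita connection with upper
  index \<open>\<rho>\<close> and lower indices \<open>\<mu>, \<nu>\<close>.\<close>

definition christoffel :: "'n::finite metric \<Rightarrow> 'n \<Rightarrow> 'n \<Rightarrow> 'n \<Rightarrow> real ^ 'n \<Rightarrow> real" where
  "christoffel g \<rho> \<mu> \<nu> p =
     (1/2) * (\<Sum>\<sigma>\<in>UNIV. ginv g \<rho> \<sigma> p *
        (pd \<mu> (\<lambda>q. g q $ \<nu> $ \<sigma>) p + pd \<nu> (\<lambda>q. g q $ \<mu> $ \<sigma>) p - pd \<sigma> (\<lambda>q. g q $ \<mu> $ \<nu>) p))"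

text \<open>\<open>riemann g \<rho> \<sigma> \<mu> \<nu>\<close> has upper index \<open>\<rho>\<close> and lower indices \<open>\<sigma>, \<mu>, \<nu>\<close>.  The Ricci tensor
  contracts the first and third index; with these signs round spheres have positive
  scalar curvature.\<close>

definition riemann :: "'n::finite metric \<Rightarrow> 'n \<Rightarrow> 'n \<Rightarrow> 'n \<Rightarrow> 'n \<Rightarrow> real ^ 'n \<Rightarrow> real" where
  "riemann g \<rho> \<sigma> \<mu> \<nu> p =
     pd \<mu> (christoffel g \<rho> \<nu> \<sigma>) p - pd \<nu> (christoffel g \<rho> \<mu> \<sigma>) p
     + (\<Sum>\<kappa>\<in>UNIV. christoffel g \<rho> \<mu> \<kappa> p * christoffel g \<kappa> \<nu> \<sigma> p)
     - (\<Sum>\<kappa>\<in>UNIV. christoffel g \<rho> \<nu> \<kappa> p * christoffel g \<kappa> \<mu> \<sigma> p)"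

definition ricci :: "'n::finite metric \<Rightarrow> 'n \<Rightarrow> 'n \<Rightarrow> real ^ 'n \<Rightarrow> real" where
  "ricci g \<mu> \<nu> p = (\<Sum>\<rho>\<in>UNIV. riemann g \<rho> \<mu> \<rho> \<nu> p)"

definition ricci_scalar :: "'n::finite metric \<Rightarrow> real ^ 'n \<Rightarrow> real" where
  "ricci_scalar g p = (\<Sum>\<mu>\<in>UNIV. \<Sum>\<nu>\<in>UNIV. ginv g \<mu> \<nu> p * ricci g \<mu> \<nu> p)"

definition cov_deriv_covector ::
    "'n::finite metric \<Rightarrow> 'n \<Rightarrow> ('n \<Rightarrow> real ^ 'n \<Rightarrow> real) \<Rightarrow> 'n \<Rightarrow> real ^ 'n \<Rightarrow> real" where
  "cov_deriv_covector g \<mu> w \<nu> p =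
     pd \<mu> (w \<nu>) p - (\<Sum>\<kappa>\<in>UNIV. christoffel g \<kappa> \<mu> \<nu> p * w \<kappa> p)"

definition hess :: "'n::finite metric \<Rightarrow> (real ^ 'n \<Rightarrow> real) \<Rightarrow> 'n \<Rightarrow> 'n \<Rightarrow> real ^ 'n \<Rightarrow> real" where
  "hess g f \<mu> \<nu> = cov_deriv_covector g \<mu> (\<lambda>\<kappa>. pd \<kappa> f) \<nu>"

definition dAlembert :: "'n::finite metric \<Rightarrow> (real ^ 'n \<Rightarrow> real) \<Rightarrow> real ^ 'n \<Rightarrow> real" where
  "dAlembert g f p = (\<Sum>\<mu>\<in>UNIV. \<Sum>\<nu>\<in>UNIV. ginv g \<mu> \<nu> p * hess g f \<mu> \<nu> p)"

definition grad_sq :: "'n::finite metric \<Rightarrow> (real ^ 'n \<Rightarrow> real) \<Rightarrow> real ^ 'n \<Rightarrow> real" where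
  "grad_sq g f p = (\<Sum>\<mu>\<in>UNIV. \<Sum>\<nu>\<in>UNIV. ginv g \<mu> \<nu> p * pd \<mu> f p * pd \<nu> f p)"


section \<open>The family of metrics and scalar fields\<close>

text \<open>
  The coordinates \<open>(u, v, x, y)\<close> of \<open>p :: real ^ 4\<close> are \<open>p $ 1, p $ 2, p $ 3, p $ 4\<close>; the flow
  parameter is called \<open>t\<close>.
\<close>

definition region :: "real \<Rightarrow> real \<Rightarrow> real \<Rightarrow> (real ^ 4) set" where
  "region r0 a t = {p. p $ 1 * p $ 2 < r0\<^sup>2 * exp (2 * a * t)}"

text \<open>The line element \<open>- F du dv + dx\<^sup>2 + dy\<^sup>2\<close>: both off-diagonal components are \<open>- F / 2\<close>.\<close>

definition null_metric :: "real \<Rightarrow> real ^ 4 ^ 4" where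
  "null_metric F = vector [
     vector [0, - F / 2, 0, 0],
     vector [- F / 2, 0, 0, 0],
     vector [0, 0, 1, 0],
     vector [0, 0, 0, 1]]"

definition flow_metric :: "real \<Rightarrow> real \<Rightarrow> real \<Rightarrow> real \<Rightarrow> 4 metric" where
  "flow_metric ks r0 a t p =
     null_metric (1 / ks\<^sup>2 * (1 / (r0\<^sup>2 * exp (2 * a * t) - p $ 1 * p $ 2)))"

definition flow_scalar :: "real \<Rightarrow> real \<Rightarrow> real \<Rightarrow> real \<Rightarrow> real \<Rightarrow> real ^ 4 \<Rightarrow> real" where
  "flow_scalar ks r0 a \<Phi>0 t p =
     - (3/5) * ln (ks\<^sup>2 * (r0\<^sup>2 * exp (2 * a * t) - p $ 1 * p $ 2)) + \<Phi>0"

definition horizon_radius :: "real \<Rightarrow> real \<Rightarrow> real \<Rightarrow> real" where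
  "horizon_radius r0 a t = r0 * exp (a * t)"

end

theory Submission
  imports Defs
begin

text \<open>
  Write \<open>B = r0\<^sup>2 exp (2 a t)\<close> and \<open>D = B - u v\<close>.  The \<open>(u, v)\<close> part of the metric is conformally flat, so
  the only nonzero Christoffel symbols are \<open>\<Gamma>\<^sup>u\<^sub>u\<^sub>u = v / D\<close> and \<open>\<Gamma>\<^sup>v\<^sub>v\<^sub>v = u / D\<close>.  Both the Ricci tensor
  and the Hessian of the scalar have only a \<open>u v\<close> component, equal to \<open>- B / D\<^sup>2\<close> and \<open>3/5 B / D\<^sup>2\<close>; the
  factor \<open>3/5\<close> and the value of \<open>ks\<^sup>2\<close> turn the tensor equation into an identity, and the constant
  part of the scalar equation fixes \<open>a\<close>.
\<close>

section \<open>Partial derivatives and smooth functions\<close>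

text \<open>The chain rule along the line \<open>t \<mapsto> p + t *\<^sub>R axis i 1\<close>. Since
  \<open>pd\<close> is a bare \<open>deriv\<close>, this is the passage from the Frechet derivative
  to its values.\<close>

lemma pd_eq_has_derivative:
  fixes f :: "real ^ 'n::finite \<Rightarrow> real"
  assumes "(f has_derivative f') (at p)"
  shows "pd i f p = f' (axis i 1)"
proof -
  have "((\<lambda>t. p + t *\<^sub>R axis i 1) has_derivative (\<lambda>t. t *\<^sub>R axis i 1)) (at (0::real))"
    by (auto intro!: derivative_eq_intros)
  moreover have "(f has_derivative f') (at (p + 0 *\<^sub>R axis i 1))"
    using assms by simp
  ultimately have "((\<lambda>t. f (p + t *\<^sub>R axis i 1)) has_derivative (\<lambda>t. f' (t *\<^sub>R axis i 1))) (at 0)"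
    by (rule has_derivative_compose)
  moreover have "(\<lambda>t. f' (t *\<^sub>R axis i 1)) = (*) (f' (axis i 1))"
    using linear_scale[OF has_derivative_linear[OF assms]] by auto
  ultimately show ?thesis
    unfolding pd_def by (intro DERIV_imp_deriv) (simp add: has_field_derivative_def)
qed

lemma has_derivative_frechet:
  "f differentiable (at p) \<Longrightarrow> (f has_derivative frechet_derivative f (at p)) (at p)"
  by (simp add: frechet_derivative_works)

lemma pd_const [simp]: "pd i (\<lambda>q. c) = (\<lambda>p. 0)"
  by (simp add: pd_def fun_eq_iff)

lemma pd_add:
  assumes "f differentiable (at p)" "g differentiable (at p)"
  shows "pd i (\<lambda>q. f q + g q) p = pd i f p + pd i g p"
  using pd_eq_has_derivative[OF has_derivative_add[OF assms[THEN has_derivative_frechet]]]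
    assms[THEN has_derivative_frechet, THEN pd_eq_has_derivative] by metis

lemma pd_mult:
  assumes "f differentiable (at p)" "g differentiable (at p)"
  shows "pd i (\<lambda>q. f q * g q) p = f p * pd i g p + pd i f p * g p"
  using pd_eq_has_derivative[OF has_derivative_mult[OF assms[THEN has_derivative_frechet]]]
    assms[THEN has_derivative_frechet, THEN pd_eq_has_derivative] by metis

text \<open>Every field in question is a one-variable function (reciprocal or logarithm) of one
  polynomial, so a scalar outer function is enough.\<close>

lemma pd_chain:
  fixes f :: "real ^ 'n::finite \<Rightarrow> real"
  assumes "f differentiable (at p)" "(h has_real_derivative d) (at (f p))"
  shows "(\<lambda>q. h (f q)) differentiable (at p)" "pd i (\<lambda>q. h (f q)) p = d * pd i f p"
proof -
  have *: "((\<lambda>q. h (f q)) has_derivative (\<lambda>x. d * frechet_derivative f (at p) x)) (at p)"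
    using has_derivative_compose[OF has_derivative_frechet[OF assms(1)]
        assms(2)[unfolded has_field_derivative_def]] .
  then show "(\<lambda>q. h (f q)) differentiable (at p)"
    by (rule differentiableI)
  show "pd i (\<lambda>q. h (f q)) p = d * pd i f p"
    using pd_eq_has_derivative[OF *]
      pd_eq_has_derivative[OF has_derivative_frechet[OF assms(1)]] by metis
qed

text \<open>By openness the line through \<open>p\<close> stays in \<open>S\<close> for small
  \<open>t\<close>, so the two restrictions agree near 0. This permits differentiating closed forms
  that are valid only on \<open>S\<close>.\<close>

lemma pd_cong_open:
  fixes f g :: "real ^ 'n::finite \<Rightarrow> real"
  assumes "open S" "p \<in> S" "\<And>q. q \<in> S \<Longrightarrow> f q = g q"
  shows "pd i f p = pd i g p"
  unfolding pd_def
proof (rule deriv_cong_ev)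
  have "((\<lambda>t. p + t *\<^sub>R axis i 1) \<longlongrightarrow> p + 0 *\<^sub>R axis i 1) (nhds (0::real))"
    by (intro tendsto_intros filterlim_ident)
  then have "((\<lambda>t. p + t *\<^sub>R axis i 1) \<longlongrightarrow> p) (nhds (0::real))" by simp
  from topological_tendstoD[OF this assms(1,2)]
  show "\<forall>\<^sub>F t in nhds 0. f (p + t *\<^sub>R axis i 1) = g (p + t *\<^sub>R axis i 1)"
    by eventually_elim (rule assms(3))
qed simp

section \<open>Closure properties of C^k functions on an open set\<close>

lemma Ck_on_cong:
  assumes "open S" "\<And>q. q \<in> S \<Longrightarrow> f q = g q"
  shows "Ck_on k S f = Ck_on k S g"
  using assms(2)
proof (induction k arbitrary: f g)
  case 0
  then show ?case using continuous_on_cong[OF refl, of S f g] by simp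
next
  case (Suc k)
  have "f differentiable (at p) \<longleftrightarrow> g differentiable (at p)" if "p \<in> S" for p
    unfolding differentiable_def
    using has_derivative_transform_within_open[OF _ assms(1) that, of f _ UNIV g]
      has_derivative_transform_within_open[OF _ assms(1) that, of g _ UNIV f] Suc.prems
    by auto
  moreover have "Ck_on k S (pd i f) = Ck_on k S (pd i g)" for i
    by (rule Suc.IH) (rule pd_cong_open[OF assms(1) _ Suc.prems])
  ultimately show ?case by auto
qed

text \<open>Continuity of lower derivatives is not part of the recursive clause; it comes from
  differentiability at the bottom of the recursion.\<close>

lemma Ck_on_Suc_imp: "Ck_on (Suc k) S f \<Longrightarrow> Ck_on k S f"
proof (induction k arbitrary: f)
  case 0
  then show ?case
    by (auto intro!: continuous_at_imp_continuous_on differentiable_imp_continuous_within)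
next
  case (Suc k)
  then show ?case by (metis Ck_on.simps(2))
qed

lemma Ck_on_const: "Ck_on k S (\<lambda>q. c)"
  by (induction k arbitrary: c) auto

lemma Ck_on_add:
  assumes "open S" "Ck_on k S f" "Ck_on k S g"
  shows "Ck_on k S (\<lambda>q. f q + g q)"
  using assms(2,3)
proof (induction k arbitrary: f g)
  case 0
  then show ?case by (auto intro: continuous_intros)
next
  case (Suc k)
  have "Ck_on k S (pd i (\<lambda>q. f q + g q))" for i
    using Suc.IH[of "pd i f" "pd i g"] Suc.prems
    by (subst Ck_on_cong[OF assms(1), of _ "\<lambda>p. pd i f p + pd i g p"]) (auto simp: pd_add)
  with Suc.prems show ?case by (auto intro: differentiable_add)
qed

text \<open>The product rule brings back the undifferentiated \<open>f\<close> and \<open>g\<close>,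
  which enter the induction hypothesis after their order is lowered by one.\<close>

lemma Ck_on_mult:
  assumes "open S" "Ck_on k S f" "Ck_on k S g"
  shows "Ck_on k S (\<lambda>q. f q * g q)"
  using assms(2,3)
proof (induction k arbitrary: f g)
  case 0
  then show ?case by (auto intro: continuous_intros)
next
  case (Suc k)
  have "Ck_on k S (\<lambda>p. f p * pd i g p + pd i f p * g p)" for i
    using Suc.prems Suc.prems[THEN Ck_on_Suc_imp] by (intro Ck_on_add[OF assms(1)] Suc.IH) auto
  then have "Ck_on k S (pd i (\<lambda>q. f q * g q))" for i
    using Suc.prems
    by (subst Ck_on_cong[OF assms(1), of _ "\<lambda>p. f p * pd i g p + pd i f p * g p"])
      (auto simp: pd_mult)
  with Suc.prems show ?case by (auto intro: differentiable_mult)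
qed

text \<open>The derivative of \<open>1/f\<close> is \<open>- (1/f) * (1/f)\<close> times that of
  \<open>f\<close>, again a product involving \<open>1/f\<close>; hence the induction closes with
  \<open>f\<close> fixed.\<close>

lemma Ck_on_inverse:
  assumes "open S" "Ck_on k S f" "\<And>q. q \<in> S \<Longrightarrow> f q \<noteq> 0"
  shows "Ck_on k S (\<lambda>q. inverse (f q))"
  using assms(2)
proof (induction k)
  case 0
  then show ?case using assms(3) by (auto intro: continuous_intros)
next
  case (Suc k)
  have D: "(inverse has_real_derivative - (inverse (f q) * inverse (f q))) (at (f q))"
    if "q \<in> S" for q
    using DERIV_inverse[OF assms(3)[OF that]] by (simp add: power2_eq_square)
  have "Ck_on k S (\<lambda>p. (-1) * (inverse (f p) * inverse (f p)) * pd i f p)" for i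
    using Suc.IH[OF Ck_on_Suc_imp[OF Suc.prems]] Suc.prems
    by (intro Ck_on_mult[OF assms(1)] Ck_on_const) auto
  then have "Ck_on k S (pd i (\<lambda>q. inverse (f q)))" for i
    using Suc.prems
    by (subst Ck_on_cong[OF assms(1),
          of _ "\<lambda>p. (-1) * (inverse (f p) * inverse (f p)) * pd i f p"])
      (auto simp: pd_chain(2)[OF _ D])
  moreover have "(\<lambda>q. inverse (f q)) differentiable (at q)" if "q \<in> S" for q
    using pd_chain(1)[of f q, OF _ D[OF that]] Suc.prems that by auto
  ultimately show ?case by simp
qed

text \<open>One differentiation turns the logarithm into \<open>inverse (f q)\<close> times a
  derivative of \<open>f\<close>, so a case split on \<open>k\<close> reduces the claim to
  reciprocals and products.\<close>

lemma Ck_on_ln: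
  assumes "open S" "Ck_on k S f" "\<And>q. q \<in> S \<Longrightarrow> f q > 0"
  shows "Ck_on k S (\<lambda>q. ln (f q))"
proof (cases k)
  case 0
  then show ?thesis using assms by (auto intro!: continuous_intros simp: less_imp_neq[symmetric])
next
  case (Suc k')
  have D: "(ln has_real_derivative inverse (f q)) (at (f q))" if "q \<in> S" for q
    using DERIV_ln[OF assms(3)[OF that]] .
  have "Ck_on k' S (\<lambda>q. inverse (f q))"
    using assms Ck_on_Suc_imp[of k' S f] Suc by (intro Ck_on_inverse) (auto simp: less_imp_neq[symmetric])
  then have "Ck_on k' S (\<lambda>p. inverse (f p) * pd i f p)" for i
    using assms Suc by (intro Ck_on_mult) auto
  then have "Ck_on k' S (pd i (\<lambda>q. ln (f q)))" for i
    using assms Suc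
    by (subst Ck_on_cong[OF assms(1), of _ "\<lambda>p. inverse (f p) * pd i f p"])
      (auto simp: pd_chain(2)[OF _ D])
  moreover have "(\<lambda>q. ln (f q)) differentiable (at q)" if "q \<in> S" for q
    using pd_chain(1)[of f q, OF _ D[OF that]] assms Suc that by auto
  ultimately show ?thesis using Suc by simp
qed

lemma has_derivative_component:
  "((\<lambda>q::real ^ 'n::finite. q $ j) has_derivative (\<lambda>h. h $ j)) (at p)"
  by (rule bounded_linear_imp_has_derivative[OF bounded_linear_vec_nth])

lemma pd_component:
  "pd i (\<lambda>q::real ^ 'n::finite. q $ j) = (\<lambda>p. if i = j then 1 else 0)"
proof
  fix p :: "real ^ 'n"
  show "pd i (\<lambda>q. q $ j) p = (if i = j then 1 else 0)"
    by (simp add: pd_eq_has_derivative[OF has_derivative_component] axis_def)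
qed

lemma Ck_on_component: "Ck_on k S (\<lambda>q. q $ j)"
  by (cases k) (auto simp: pd_component Ck_on_const intro!: continuous_intros
      bounded_linear_imp_differentiable bounded_linear_vec_nth)


section \<open>The metric in null coordinates\<close>

text \<open>\<open>matrix_inv\<close> is a choice among two-sided inverses. One exists by
  assumption, and associativity makes it unique.\<close>

lemma matrix_inv_eqI:
  fixes A B :: "real ^ 'n ^ 'n"
  assumes "A ** B = mat 1" "B ** A = mat 1"
  shows "matrix_inv A = B"
proof -
  have "A ** matrix_inv A = mat 1"
    unfolding matrix_inv_def
    by (rule someI2[of _ B]) (use assms in auto)
  then show ?thesis
    by (metis assms(2) matrix_mul_assoc matrix_mul_lid matrix_mul_rid)
qed

lemma vector_4 [simp]:
  "(vector [x, y, z, w] :: ('a::zero) ^ 4) $ 1 = x"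
  "(vector [x, y, z, w] :: ('a::zero) ^ 4) $ 2 = y"
  "(vector [x, y, z, w] :: ('a::zero) ^ 4) $ 3 = z"
  "(vector [x, y, z, w] :: ('a::zero) ^ 4) $ 4 = w"
  unfolding vector_def by simp_all

text \<open>An off-diagonal block with entries \<open>- F / 2\<close> inverts to one with entries
  \<open>- 2 / F\<close>, so the inverse is in the same family with parameter
  \<open>4 / F\<close>.\<close>

lemma null_metric_inverse:
  assumes "F \<noteq> 0"
  shows "null_metric F ** null_metric (4 / F) = mat 1"
  using assms
  by (simp add: null_metric_def vec_eq_iff forall_4 matrix_matrix_mult_def sum_4 mat_def)

lemma null_metric_matrix_inv:
  assumes "F \<noteq> 0"
  shows "invertible (null_metric F)" "matrix_inv (null_metric F) = null_metric (4 / F)"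
proof -
  \<comment> \<open>The map \<open>F \<mapsto> 4 / F\<close> is an involution, so the right-inverse
    identity also gives the left inverse.\<close>
  have "null_metric (4 / F) ** null_metric F = mat 1"
    using null_metric_inverse[of "4 / F"] assms by simp
  with null_metric_inverse[OF assms]
  show "invertible (null_metric F)" "matrix_inv (null_metric F) = null_metric (4 / F)"
    by (auto simp: invertible_def intro: matrix_inv_eqI)
qed

lemma transpose_null_metric: "transpose (null_metric F) = null_metric F"
  by (simp add: null_metric_def vec_eq_iff forall_4 transpose_def)

text \<open>The denominator \<open>D\<close> of the metric, that is \<open>r_h^2 - u v\<close>; the
  region is exactly where it is positive.\<close>

definition gap :: "real \<Rightarrow> real \<Rightarrow> real \<Rightarrow> real ^ 4 \<Rightarrow> real" where
  "gap r0 a t p = r0\<^sup>2 * exp (2 * a * t) - p $ 1 * p $ 2"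

lemma gap_pos: "p \<in> region r0 a t \<Longrightarrow> gap r0 a t p > 0"
  by (simp add: region_def gap_def)

lemma gap_neq_0: "p \<in> region r0 a t \<Longrightarrow> gap r0 a t p \<noteq> 0"
  using gap_pos[of p r0 a t] by simp

lemma open_region: "open (region r0 a t)"
  unfolding region_def by (intro open_Collect_less continuous_intros)

lemma has_derivative_gap:
  "(gap r0 a t has_derivative (\<lambda>h. - (p $ 1 * h $ 2 + h $ 1 * p $ 2))) (at p)"
  unfolding gap_def by (auto intro!: derivative_eq_intros has_derivative_component)

lemma Ck_on_gap: "Ck_on k (region r0 a t) (gap r0 a t)"
proof -
  have "gap r0 a t = (\<lambda>p. r0\<^sup>2 * exp (2 * a * t) + (-1) * (p $ 1 * p $ 2))"
    by (simp add: gap_def fun_eq_iff)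
  then show ?thesis
    by (simp only:) (intro Ck_on_add Ck_on_mult Ck_on_const Ck_on_component open_region)
qed

lemma flow_metric_gap: "flow_metric ks r0 a t p = null_metric (1 / ks\<^sup>2 * (1 / gap r0 a t p))"
  by (simp add: flow_metric_def gap_def)

lemma flow_scalar_gap: "flow_scalar ks r0 a \<Phi>0 t p = - (3/5) * ln (ks\<^sup>2 * gap r0 a t p) + \<Phi>0"
  by (simp add: flow_scalar_def gap_def)

text \<open>The case conditions involve only the indices, so they can be decided before
  differentiating. The nonconstant entry is a constant times a reciprocal, the form to which the
  smoothness and chain rules apply.\<close>

lemma flow_metric_entry:
  "flow_metric ks r0 a t p $ \<mu> $ \<nu> =
    (if \<mu> = 1 \<and> \<nu> = 2 \<or> \<mu> = 2 \<and> \<nu> = 1 then - (1 / (2 * ks\<^sup>2)) * inverse (gap r0 a t p)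
     else if \<mu> = \<nu> \<and> (\<mu> = 3 \<or> \<mu> = 4) then 1 else 0)"
  using exhaust_4[of \<mu>] exhaust_4[of \<nu>]
  by (elim disjE) (simp_all add: flow_metric_gap null_metric_def inverse_eq_divide)

lemma metric_on_flow_metric:
  assumes "ks \<noteq> 0"
  shows "metric_on (region r0 a t) (flow_metric ks r0 a t)"
proof -
  have C: "Ck_on k (region r0 a t) (\<lambda>p. - (1 / (2 * ks\<^sup>2)) * inverse (gap r0 a t p))" for k
    by (intro Ck_on_mult Ck_on_const Ck_on_inverse open_region Ck_on_gap gap_neq_0)
  have "smooth_on (region r0 a t) (\<lambda>p. flow_metric ks r0 a t p $ \<mu> $ \<nu>)" for \<mu> \<nu>
    unfolding smooth_on_def flow_metric_entry
    by (cases "\<mu> = 1 \<and> \<nu> = 2 \<or> \<mu> = 2 \<and> \<nu> = 1") (simp_all only: if_True if_False C Ck_on_const simp_thms)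
  moreover have "invertible (flow_metric ks r0 a t p)" if "p \<in> region r0 a t" for p
    using gap_pos[OF that] assms by (auto simp: flow_metric_gap intro!: null_metric_matrix_inv)
  ultimately show ?thesis
    by (simp add: metric_on_def flow_metric_gap transpose_null_metric)
qed

lemma smooth_on_flow_scalar:
  assumes "ks \<noteq> 0"
  shows "smooth_on (region r0 a t) (flow_scalar ks r0 a \<Phi>0 t)"
  unfolding smooth_on_def flow_scalar_gap[abs_def]
  using Ck_on_gap gap_pos assms
  by (intro allI Ck_on_add Ck_on_mult Ck_on_const Ck_on_ln open_region) auto

section \<open>Inverse metric, connection and curvature\<close>

lemma ginv_flow_metric:
  assumes "ks \<noteq> 0" "p \<in> region r0 a t"
  shows "ginv (flow_metric ks r0 a t) \<mu> \<nu> p = null_metric (4 * ks\<^sup>2 * gap r0 a t p) $ \<mu> $ \<nu>"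
  using assms gap_pos[OF assms(2)]
  by (simp add: ginv_def flow_metric_gap null_metric_matrix_inv mult.assoc)

lemma pd_flow_metric:
  assumes "ks \<noteq> 0" "p \<in> region r0 a t"
  shows "pd i (\<lambda>q. flow_metric ks r0 a t q $ \<mu> $ \<nu>) p =
    (if \<mu> = 1 \<and> \<nu> = 2 \<or> \<mu> = 2 \<and> \<nu> = 1
     then - (if i = 1 then p $ 2 else if i = 2 then p $ 1 else 0) / (2 * ks\<^sup>2 * (gap r0 a t p)\<^sup>2)
     else 0)"
proof -
  have "((\<lambda>x. - (1 / (2 * ks\<^sup>2)) * inverse x) has_real_derivative
      1 / (2 * ks\<^sup>2) * (inverse (gap r0 a t p))\<^sup>2) (at (gap r0 a t p))"
    using assms(1) gap_neq_0[OF assms(2)]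
    by (auto intro!: derivative_eq_intros simp: power2_eq_square)
  from pd_chain(2)[OF differentiableI[OF has_derivative_gap] this]
  have *: "pd i (\<lambda>q. - (1 / (2 * ks\<^sup>2)) * inverse (gap r0 a t q)) p =
      - (if i = 1 then p $ 2 else if i = 2 then p $ 1 else 0) / (2 * ks\<^sup>2 * (gap r0 a t p)\<^sup>2)"
    using exhaust_4[of i]
    by (auto simp: pd_eq_has_derivative[OF has_derivative_gap] axis_def power_divide inverse_eq_divide)
  show ?thesis
    unfolding flow_metric_entry
    by (cases "\<mu> = 1 \<and> \<nu> = 2 \<or> \<mu> = 2 \<and> \<nu> = 1") (simp_all only: if_True if_False * pd_const simp_thms)
qed

text \<open>For a line element \<open>- F du dv\<close> the surviving symbols are the derivatives of
  \<open>ln F\<close> along \<open>u\<close> and \<open>v\<close>. Here \<open>ln F\<close> is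
  \<open>- ln D\<close> up to a constant, which gives \<open>v / D\<close> and
  \<open>u / D\<close>.\<close>

lemma christoffel_flow_metric:
  assumes "ks \<noteq> 0" "p \<in> region r0 a t"
  shows "christoffel (flow_metric ks r0 a t) \<rho> \<mu> \<nu> p =
    (if \<rho> = 1 \<and> \<mu> = 1 \<and> \<nu> = 1 then p $ 2 / gap r0 a t p
     else if \<rho> = 2 \<and> \<mu> = 2 \<and> \<nu> = 2 then p $ 1 / gap r0 a t p else 0)"
proof -
  have [simp]: "gap r0 a t p \<noteq> 0" using gap_pos[OF assms(2)] by simp
  show ?thesis
    using exhaust_4[of \<mu>] exhaust_4[of \<nu>] exhaust_4[of \<rho>] assms(1)
    unfolding christoffel_def ginv_flow_metric[OF assms] pd_flow_metric[OF assms] sum_4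
    by (elim disjE) (simp_all add: null_metric_def power2_eq_square)
qed

lemma component_over_gap_has_derivative:
  assumes "p \<in> region r0 a t"
  shows "((\<lambda>q. q $ j / gap r0 a t q) has_derivative
    (\<lambda>h. (h $ j * gap r0 a t p + p $ j * (p $ 1 * h $ 2 + h $ 1 * p $ 2)) / (gap r0 a t p)\<^sup>2)) (at p)"
  using gap_pos[OF assms]
  by (auto intro!: derivative_eq_intros has_derivative_gap has_derivative_component
      simp: fun_eq_iff power2_eq_square field_simps)

lemma pd_component_over_gap:
  assumes "p \<in> region r0 a t"
  shows "pd i (\<lambda>q. q $ 1 / gap r0 a t q) p =
      (if i = 1 then r0\<^sup>2 * exp (2 * a * t) else if i = 2 then (p $ 1)\<^sup>2 else 0) / (gap r0 a t p)\<^sup>2"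
    and "pd i (\<lambda>q. q $ 2 / gap r0 a t q) p =
      (if i = 1 then (p $ 2)\<^sup>2 else if i = 2 then r0\<^sup>2 * exp (2 * a * t) else 0) / (gap r0 a t p)\<^sup>2"
proof -
  \<comment> \<open>The quotient rule for \<open>u / D\<close> along \<open>u\<close> has numerator
    \<open>D + u v\<close>, which equals \<open>B\<close> and is constant in the coordinates. The
    same holds for \<open>v / D\<close> along \<open>v\<close>.\<close>
  have *: "r0\<^sup>2 * exp (2 * a * t) = gap r0 a t p + p $ 1 * p $ 2" by (simp add: gap_def)
  note D = pd_eq_has_derivative[OF component_over_gap_has_derivative[OF assms]]
  show "pd i (\<lambda>q. q $ 1 / gap r0 a t q) p =
      (if i = 1 then r0\<^sup>2 * exp (2 * a * t) else if i = 2 then (p $ 1)\<^sup>2 else 0) / (gap r0 a t p)\<^sup>2"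
    "pd i (\<lambda>q. q $ 2 / gap r0 a t q) p =
      (if i = 1 then (p $ 2)\<^sup>2 else if i = 2 then r0\<^sup>2 * exp (2 * a * t) else 0) / (gap r0 a t p)\<^sup>2"
    using exhaust_4[of i] unfolding D *
    by (elim disjE; simp add: axis_def power2_eq_square mult.commute)+
qed

text \<open>The closed form of the symbols is known only on the region; its openness is what allows
  differentiating it there.\<close>

lemma pd_christoffel_flow_metric:
  assumes "ks \<noteq> 0" "p \<in> region r0 a t"
  shows "pd i (christoffel (flow_metric ks r0 a t) \<rho> \<mu> \<nu>) p =
    (if \<rho> = 1 \<and> \<mu> = 1 \<and> \<nu> = 1 then
       (if i = 1 then (p $ 2)\<^sup>2 else if i = 2 then r0\<^sup>2 * exp (2 * a * t) else 0) / (gap r0 a t p)\<^sup>2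
     else if \<rho> = 2 \<and> \<mu> = 2 \<and> \<nu> = 2 then
       (if i = 2 then (p $ 1)\<^sup>2 else if i = 1 then r0\<^sup>2 * exp (2 * a * t) else 0) / (gap r0 a t p)\<^sup>2
     else 0)"
  by (subst pd_cong_open[OF open_region assms(2) christoffel_flow_metric[OF assms(1)]])
    (auto simp: pd_component_over_gap[OF assms(2)])

text \<open>In the mixed component every quadratic term vanishes, because no symbol mixes
  \<open>u\<close> and \<open>v\<close>; what remains is minus the \<open>v\<close>-derivative of
  \<open>v / D\<close> or the \<open>u\<close>-derivative of \<open>u / D\<close>. In the diagonal
  components all terms cancel.\<close>

lemma ricci_flow_metric:
  assumes "ks \<noteq> 0" "p \<in> region r0 a t"
  shows "ricci (flow_metric ks r0 a t) \<mu> \<nu> p =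
    (if \<mu> = 1 \<and> \<nu> = 2 \<or> \<mu> = 2 \<and> \<nu> = 1
     then - (r0\<^sup>2 * exp (2 * a * t)) / (gap r0 a t p)\<^sup>2 else 0)"
  using exhaust_4[of \<mu>] exhaust_4[of \<nu>]
  unfolding ricci_def riemann_def christoffel_flow_metric[OF assms]
    pd_christoffel_flow_metric[OF assms] sum_4
  by (elim disjE) simp_all

text \<open>The two mixed components contribute equally, with inverse metric entry
  \<open>- 2 * ks\<^sup>2 * D\<close>.\<close>

lemma ricci_scalar_flow_metric:
  assumes "ks \<noteq> 0" "p \<in> region r0 a t"
  shows "ricci_scalar (flow_metric ks r0 a t) p =
    4 * ks\<^sup>2 * (r0\<^sup>2 * exp (2 * a * t)) / gap r0 a t p"
  using gap_pos[OF assms(2)]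
  unfolding ricci_scalar_def ricci_flow_metric[OF assms] ginv_flow_metric[OF assms] sum_4
  by (simp add: null_metric_def power2_eq_square)

section \<open>Derivatives of the scalar field\<close>

text \<open>With \<open>F = 1 / (ks\<^sup>2 * D)\<close> the scalar is \<open>3/5 * ln F\<close>
  plus a constant, so its gradient is \<open>3/5\<close> times the nonzero Christoffel
  symbols.\<close>

lemma pd_flow_scalar:
  assumes "ks \<noteq> 0" "p \<in> region r0 a t"
  shows "pd i (flow_scalar ks r0 a \<Phi>0 t) p =
    (if i = 1 then 3/5 * (p $ 2 / gap r0 a t p)
     else if i = 2 then 3/5 * (p $ 1 / gap r0 a t p) else 0)"
proof -
  have "(flow_scalar ks r0 a \<Phi>0 t has_derivative
      (\<lambda>h. 3/5 * ((p $ 1 * h $ 2 + h $ 1 * p $ 2) / gap r0 a t p))) (at p)"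
    using assms(1) gap_pos[OF assms(2)] unfolding flow_scalar_gap[abs_def]
    by (auto intro!: derivative_eq_intros has_derivative_gap simp: fun_eq_iff field_simps)
  from pd_eq_has_derivative[OF this] show ?thesis
    using exhaust_4[of i] by (auto simp: axis_def)
qed

lemma pd_pd_flow_scalar:
  assumes "ks \<noteq> 0" "p \<in> region r0 a t"
  shows "pd i (pd j (flow_scalar ks r0 a \<Phi>0 t)) p =
    (if i = 1 \<and> j = 1 then 3/5 * (p $ 2)\<^sup>2 / (gap r0 a t p)\<^sup>2
     else if i = 2 \<and> j = 2 then 3/5 * (p $ 1)\<^sup>2 / (gap r0 a t p)\<^sup>2
     else if i = 1 \<and> j = 2 \<or> i = 2 \<and> j = 1
       then 3/5 * (r0\<^sup>2 * exp (2 * a * t)) / (gap r0 a t p)\<^sup>2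
     else 0)"
proof -
  have "(\<lambda>q. q $ j / gap r0 a t q) differentiable (at p)" for j
    using component_over_gap_has_derivative[OF assms(2)] by (rule differentiableI)
  then have *: "pd i (\<lambda>q. 3/5 * (q $ j / gap r0 a t q)) p = 3/5 * pd i (\<lambda>q. q $ j / gap r0 a t q) p" for j
    by (subst pd_mult) auto
  have E: "pd i (pd j (flow_scalar ks r0 a \<Phi>0 t)) p = pd i (\<lambda>q.
      if j = 1 then 3/5 * (q $ 2 / gap r0 a t q)
      else if j = 2 then 3/5 * (q $ 1 / gap r0 a t q) else 0) p"
    by (rule pd_cong_open[OF open_region assms(2) pd_flow_scalar[OF assms(1)]])
  have n12: "(2::4) \<noteq> 1" by simp
  consider "j = 1" | "j = 2" | "j \<noteq> 1" "j \<noteq> 2" by blast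
  then show ?thesis
  proof cases
    case 1
    then show ?thesis
      unfolding E
      by (simp only: if_True simp_thms * pd_component_over_gap[OF assms(2)]) simp
  next
    case 2
    then show ?thesis
      unfolding E
      by (simp only: n12 if_True if_False simp_thms * pd_component_over_gap[OF assms(2)]) simp
  next
    case 3
    then show ?thesis
      unfolding E
      by simp
  qed
qed

text \<open>In the diagonal components the connection term removes exactly the second derivative. In
  the mixed component there is no connection term, so the Hessian is \<open>- 3/5\<close> times the
  Ricci tensor.\<close>

lemma hess_flow_scalar:
  assumes "ks \<noteq> 0" "p \<in> region r0 a t"
  shows "hess (flow_metric ks r0 a t) (flow_scalar ks r0 a \<Phi>0 t) \<mu> \<nu> p =
    (if \<mu> = 1 \<and> \<nu> = 2 \<or> \<mu> = 2 \<and> \<nu> = 1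
     then 3/5 * (r0\<^sup>2 * exp (2 * a * t)) / (gap r0 a t p)\<^sup>2 else 0)"
  using exhaust_4[of \<mu>] exhaust_4[of \<nu>]
  unfolding hess_def cov_deriv_covector_def christoffel_flow_metric[OF assms]
    pd_flow_scalar[OF assms] pd_pd_flow_scalar[OF assms] sum_4
  by (elim disjE) (simp_all add: power2_eq_square)

lemma dAlembert_flow_scalar:
  assumes "ks \<noteq> 0" "p \<in> region r0 a t"
  shows "dAlembert (flow_metric ks r0 a t) (flow_scalar ks r0 a \<Phi>0 t) p =
    - (12/5) * ks\<^sup>2 * (r0\<^sup>2 * exp (2 * a * t)) / gap r0 a t p"
  using gap_pos[OF assms(2)]
  unfolding dAlembert_def hess_flow_scalar[OF assms] ginv_flow_metric[OF assms] sum_4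
  by (simp add: null_metric_def power2_eq_square)

text \<open>The product \<open>u v\<close> is kept here; writing it as \<open>B - D\<close> later
  splits off the constant that balances \<open>\<delta>c\<close>.\<close>

lemma grad_sq_flow_scalar:
  assumes "ks \<noteq> 0" "p \<in> region r0 a t"
  shows "grad_sq (flow_metric ks r0 a t) (flow_scalar ks r0 a \<Phi>0 t) p =
    - (36/25) * ks\<^sup>2 * (p $ 1 * p $ 2) / gap r0 a t p"
  using gap_pos[OF assms(2)]
  unfolding grad_sq_def pd_flow_scalar[OF assms] ginv_flow_metric[OF assms] sum_4
  by (simp add: null_metric_def power2_eq_square)


section \<open>The flow equations\<close>

lemma gap_has_real_derivative:
  "((\<lambda>s. gap r0 a s p) has_real_derivative 2 * a * (r0\<^sup>2 * exp (2 * a * t))) (at t)"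
  unfolding gap_def by (auto intro!: derivative_eq_intros)

lemma flow_metric_has_real_derivative:
  assumes "ks \<noteq> 0" "p \<in> region r0 a t"
  shows "((\<lambda>s. flow_metric ks r0 a s p $ \<mu> $ \<nu>) has_real_derivative
    (if \<mu> = 1 \<and> \<nu> = 2 \<or> \<mu> = 2 \<and> \<nu> = 1
     then a * (r0\<^sup>2 * exp (2 * a * t)) / (ks\<^sup>2 * (gap r0 a t p)\<^sup>2) else 0)) (at t)"
proof -
  have D: "((\<lambda>s. - (1 / (2 * ks\<^sup>2)) * inverse (gap r0 a s p)) has_real_derivative
      a * (r0\<^sup>2 * exp (2 * a * t)) / (ks\<^sup>2 * (gap r0 a t p)\<^sup>2)) (at t)"
    using assms(1) gap_neq_0[OF assms(2)]
    by (auto intro!: derivative_eq_intros gap_has_real_derivative simp: power2_eq_square divide_simps)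
  show ?thesis
    unfolding flow_metric_entry
    by (cases "\<mu> = 1 \<and> \<nu> = 2 \<or> \<mu> = 2 \<and> \<nu> = 1")
      (simp_all only: if_True if_False D DERIV_const simp_thms)
qed

lemma flow_scalar_has_real_derivative:
  assumes "ks \<noteq> 0" "p \<in> region r0 a t"
  shows "((\<lambda>s. flow_scalar ks r0 a \<Phi>0 s p) has_real_derivative
    - (6/5) * a * (r0\<^sup>2 * exp (2 * a * t)) / gap r0 a t p) (at t)"
  using assms(1) gap_pos[OF assms(2)] unfolding flow_scalar_gap
  by (auto intro!: derivative_eq_intros gap_has_real_derivative simp: field_simps)

lemma horizon_radius_tendsto_0:
  assumes "a < 0"
  shows "(horizon_radius r0 a \<longlongrightarrow> 0) at_top"
proof -
  have "filterlim (\<lambda>t. a * t) at_bot at_top"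
    using assms by (intro filterlim_tendsto_neg_mult_at_bot[OF tendsto_const]) (auto simp: filterlim_ident)
  then have "((\<lambda>t. r0 * exp (a * t)) \<longlongrightarrow> r0 * 0) at_top"
    by (intro tendsto_mult tendsto_const filterlim_compose[OF exp_at_bot])
  then show ?thesis by (simp add: horizon_radius_def[abs_def])
qed

theorem mainTheorem3:
  fixes \<alpha>' \<delta>c r0 \<Phi>0 a ks :: real
  assumes "\<alpha>' > 0" and "\<delta>c > 0" and "r0 > 0"
    and "a = - (5 * \<delta>c / 216)"
    and "ks\<^sup>2 = - (5 * a / \<alpha>')"
  defines "g \<equiv> flow_metric ks r0 a" and "\<Phi> \<equiv> flow_scalar ks r0 a \<Phi>0"
  shows "a < 0 \<and>
    (\<forall>t. metric_on (region r0 a t) (g t) \<and> smooth_on (region r0 a t) (\<Phi> t)) \<and>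
    (\<forall>t. \<forall>p \<in> region r0 a t.
       (\<forall>\<mu> \<nu>. ((\<lambda>s. g s p $ \<mu> $ \<nu>) has_real_derivative
           - \<alpha>' * (ricci (g t) \<mu> \<nu> p + 2 * hess (g t) (\<Phi> t) \<mu> \<nu> p)) (at t)) \<and>
       ((\<lambda>s. \<Phi> s p) has_real_derivative
           \<delta>c - 3/2 * \<alpha>' * (4 * grad_sq (g t) (\<Phi> t) p - 4 * dAlembert (g t) (\<Phi> t) p
                              - ricci_scalar (g t) p)) (at t)) \<and>
    (horizon_radius r0 a \<longlongrightarrow> 0) at_top"
proof (intro conjI allI ballI)
  show a: "a < 0" using assms by simp
  then have ks: "ks \<noteq> 0" using assms(1,5) by auto
  \<comment> \<open>The products of constants occurring in the flow equations are expressed through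
    \<open>a\<close> alone.\<close>
  have \<alpha>: "\<alpha>' * ks\<^sup>2 = - 5 * a" using assms(1,5) by simp
  have \<delta>: "\<delta>c = - (216/5) * a" using assms(4) by simp
  show "(horizon_radius r0 a \<longlongrightarrow> 0) at_top"
    using a by (rule horizon_radius_tendsto_0)
  fix t
  show "metric_on (region r0 a t) (g t)" "smooth_on (region r0 a t) (\<Phi> t)"
    unfolding g_def \<Phi>_def using ks by (rule metric_on_flow_metric smooth_on_flow_scalar)+
  fix p assume p: "p \<in> region r0 a t"
  define B where "B = r0\<^sup>2 * exp (2 * a * t)"
  define D where "D = gap r0 a t p"
  have D: "D > 0" "p $ 1 * p $ 2 = B - D"
    using gap_pos[OF p] by (simp_all add: D_def B_def gap_def)
  \<comment> \<open>This is the mixed component of the tensor equation: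
    \<open>- 1 + 6/5 = 1/5\<close> on the right, matched by
    \<open>a = - (\<alpha>' * ks\<^sup>2) / 5\<close>.\<close>
  have "a * B / (ks\<^sup>2 * D\<^sup>2) = - \<alpha>' * (- B / D\<^sup>2 + 2 * (3/5 * B / D\<^sup>2))"
  proof -
    have "a = - (\<alpha>' * ks\<^sup>2) / 5" using \<alpha> by simp
    then show ?thesis using D(1) ks by (simp add: field_simps)
  qed
  then show "((\<lambda>s. g s p $ \<mu> $ \<nu>) has_real_derivative
      - \<alpha>' * (ricci (g t) \<mu> \<nu> p + 2 * hess (g t) (\<Phi> t) \<mu> \<nu> p)) (at t)" for \<mu> \<nu>
    using flow_metric_has_real_derivative[OF ks p, of \<mu> \<nu>]
    unfolding g_def \<Phi>_def ricci_flow_metric[OF ks p] hess_flow_scalar[OF ks p]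
      B_def[symmetric] D_def[symmetric]
    by (auto split: if_splits)
  \<comment> \<open>After \<open>u v = B - D\<close>, the coefficients of \<open>B / D\<close> add
    up to \<open>- 144/25 + 48/5 - 4 = - 4/25\<close>, and the gradient term leaves the constant
    \<open>144/25\<close>.\<close>
  have "\<delta>c - 3/2 * \<alpha>' * (4 * (- (36/25) * ks\<^sup>2 * (B - D) / D) - 4 * (- (12/5) * ks\<^sup>2 * B / D)
      - 4 * ks\<^sup>2 * B / D) = \<delta>c - 3/2 * (\<alpha>' * ks\<^sup>2) * (144/25 - 4/25 * (B / D))"
    using D(1) by (simp add: field_simps)
  \<comment> \<open>The constant contributes \<open>216/5 * a\<close>, which cancels
    \<open>\<delta>c\<close>; this is where the value of \<open>a\<close> comes from.\<close>
  also have "\<dots> = - (6/5) * a * B / D"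
    unfolding \<alpha> \<delta> using D(1) by (simp add: field_simps)
  finally show "((\<lambda>s. \<Phi> s p) has_real_derivative
      \<delta>c - 3/2 * \<alpha>' * (4 * grad_sq (g t) (\<Phi> t) p - 4 * dAlembert (g t) (\<Phi> t) p
                         - ricci_scalar (g t) p)) (at t)"
    using flow_scalar_has_real_derivative[OF ks p, of \<Phi>0]
    unfolding g_def \<Phi>_def grad_sq_flow_scalar[OF ks p] dAlembert_flow_scalar[OF ks p]
      ricci_scalar_flow_metric[OF ks p] B_def[symmetric] D_def[symmetric] D(2)
    by simp
qed

end
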